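(* For every integer $n\ge 2$ there is an arrangement of $n$ points in $\mathbb{R}^3$ such that the number of affine simplexes determined by them (i.e. the number of subsets of the point set that are affine simplexes) is only - $\binom{n-1}{4}-\frac{(n-2)(n-5)}{2}$ if $n$ is even, - $\binom{n-1}{4}-\frac{(n-3)(n-5)}{2}$ if $n$ is odd; that is, $\frac{1}{24}n^4-\frac{5}{12}n^3+O(n^2)$.
   Context: A set $A$ of $k\ge 3$ points in $\mathbb{R}^3$ is called an affine simplex if $A$ is contained in some $(k-2)$-dimensional affine subspace, but no nonempty proper subset $A'\subsetneq A$ is contained in an affine subspace of dimension $|A'|-2$. In $\mathbb{R}^3$ the affine simplexes are exactly: three collinear points; four coplanar points no three of which are collinear; five points no four of which are coplanar. *)

theory Defs
  imports "HOL-Analysis.Analysis" "HOL-Library.Landau_Symbols"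
begin

text \<open>
  A proper subset with one point is vacuously unproblematic here: it would have to lie in an
  affine subspace of dimension \<open>-1\<close>, and the only affine set with \<open>aff_dim\<close> equal to \<open>-1\<close>
  is the empty one.
\<close>

definition affine_simplex :: "(real ^ 3) set \<Rightarrow> bool" where
  "affine_simplex A \<longleftrightarrow>
     finite A \<and> card A \<ge> 3 \<and>
     (\<exists>S. affine S \<and> aff_dim S = int (card A) - 2 \<and> A \<subseteq> S) \<and>
     \<not> (\<exists>A'. A' \<noteq> {} \<and> A' \<subset> A \<and>
          (\<exists>S. affine S \<and> aff_dim S = int (card A') - 2 \<and> A' \<subseteq> S))"

definition num_affine_simplexes :: "(real ^ 3) set \<Rightarrow> nat" where
  "num_affine_simplexes P = card {A. A \<subseteq> P \<and> affine_simplex A}"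

text \<open>
  The value is taken in the reals because for \<open>n < 5\<close> the factor \<open>n - 5\<close> is negative; at
  \<open>n = 4\<close>, for instance, the value is 1.
\<close>

definition simplex_value :: "nat \<Rightarrow> real" where
  "simplex_value n =
     (if even n
      then real ((n - 1) choose 4) - (real n - 2) * (real n - 5) / 2
      else real ((n - 1) choose 4) - (real n - 3) * (real n - 5) / 2)"

end

theory Submission
  imports Defs
begin

text \<open>
  Take two points \<open>u = (0,0,1)\<close> and \<open>v = (1,0,1)\<close> above the plane \<open>z = 0\<close>, and in that plane
  \<open>N = n - 2\<close> points \<open>(t, t\<^sup>2, 0)\<close> of a parabola, where \<open>t\<close> runs over a finite set \<open>T\<close> of reals
  that is symmetric about \<open>0\<close>.  No three points of the parabola are collinear, so every four of
  them form an affine simplex.  The line \<open>uv\<close> is parallel to the plane and has the direction of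
  exactly those chords of the parabola that join opposite parameters \<open>s\<close> and \<open>- s\<close>.  Hence \<open>u\<close>,
  \<open>v\<close> and two points of the parabola are coplanar precisely when these have opposite parameters,
  and \<open>u\<close>, \<open>v\<close> and three points of the parabola form an affine simplex precisely when no two of
  the three do.  There are no other affine simplexes: in a set that contains just one of \<open>u\<close> and
  \<open>v\<close>, this point is the only one outside the plane \<open>z = 0\<close> and so takes part in no dependence.

  If \<open>m\<close> is the number of opposite pairs in \<open>T\<close>, then \<open>m * (N - 2)\<close> triples contain such a pair,
  so there are
  \<open>(N choose 4) + m + (N choose 3) - m * (N - 2) = (N + 1 choose 4) - m * (N - 3)\<close>
  affine simplexes.  Each pair saves \<open>N - 3\<close> of them; taking as many pairs as possible,
  \<open>m = N div 2\<close>, yields the value claimed, and the two parities of \<open>n\<close> come from this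
  rounding.

  All geometry is phrased through affine dependence: affine simplexes are the minimal affinely
  dependent sets (\<open>affine_simplex_iff_minimal_dependent\<close>), so it suffices to know which subsets
  of the configuration are dependent.  Dependence comes from dimension bounds or from an explicit
  combination, independence from affine functions that vanish on all points but one.  The
  classification of the minimal dependent sets is in \<open>affine_simplex_parabola_iff\<close>,
  \<open>not_affine_simplex_one_apex\<close> and \<open>affine_simplex_configuration_iff\<close>.
\<close>

section \<open>Affine simplexes as minimal affinely dependent sets\<close>

text \<open>
  The definition of affine simplexes asks for a superspace of exactly the dimension
  \<open>card A - 2\<close>, whereas dependence only bounds the dimension of the hull from above.  Adding
  points outside the hull one at a time closes the gap.
\<close>

lemma affine_superset_of_aff_dim:
  fixes A :: "'a::euclidean_space set"
  assumes "aff_dim A \<le> d" "d \<le> int DIM('a)"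
  shows "\<exists>S. affine S \<and> aff_dim S = d \<and> A \<subseteq> S"
  using assms
proof (induction "nat (d - aff_dim A)" arbitrary: A)
  case 0
  then have "aff_dim (affine hull A) = d"
    by simp
  then show ?case
    by (intro exI[of _ "affine hull A"]) (simp add: hull_subset)
next
  case (Suc k)
  then have "aff_dim A < int DIM('a)"
    by linarith
  then have "affine hull A \<noteq> UNIV"
    by (metis aff_dim_affine_hull aff_dim_UNIV less_irrefl)
  then obtain x where "x \<notin> affine hull A"
    by blast
  then have "aff_dim (insert x A) = aff_dim A + 1"
    by (simp add: aff_dim_insert)
  then have "k = nat (d - aff_dim (insert x A))" "aff_dim (insert x A) \<le> d"
    using Suc.hyps(2) by linarith+
  then obtain S where "affine S" "aff_dim S = d" "insert x A \<subseteq> S"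
    using Suc.hyps(1) Suc.prems(2) by metis
  then show ?case
    by blast
qed

lemma affine_dependent_iff_aff_dim_le:
  fixes A :: "'a::euclidean_space set"
  assumes "finite A"
  shows "affine_dependent A \<longleftrightarrow> aff_dim A \<le> int (card A) - 2"
  using affine_independent_iff_card[of A] aff_dim_le_card[OF assms] assms by linarith

text \<open>
  A superspace of dimension \<open>card A' - 2\<close> must fit into the ambient space.  For proper subsets
  \<open>A'\<close> of an affine simplex \<open>A\<close> it does, since already the larger dimension \<open>card A - 2\<close> occurs.
  Conversely, in a minimal dependent set some point lies in the hull of the others, which are
  independent; so the hull of the whole set has dimension exactly \<open>card A - 2\<close>.
\<close>

lemma affine_simplex_iff_minimal_dependent:
  "affine_simplex A \<longleftrightarrow>
     finite A \<and> affine_dependent A \<and> (\<forall>A'. A' \<subset> A \<longrightarrow> \<not> affine_dependent A')"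
proof
  assume A: "affine_simplex A"
  then obtain S where S: "finite A" "affine S" "aff_dim S = int (card A) - 2" "A \<subseteq> S"
    unfolding affine_simplex_def by blast
  have "affine_dependent A"
    using S aff_dim_subset[of A S] by (simp add: affine_dependent_iff_aff_dim_le)
  moreover have "\<not> affine_dependent A'" if A': "A' \<subset> A" for A'
  proof
    assume dep: "affine_dependent A'"
    have fin: "finite A'"
      using A' S(1) finite_subset by blast
    have "int (card A') - 2 \<le> int DIM(real^3)"
      using psubset_card_mono[OF S(1) A'] aff_dim_le_DIM[of S] S(3) by linarith
    then have "\<exists>S'. affine S' \<and> aff_dim S' = int (card A') - 2 \<and> A' \<subseteq> S'"
      using dep fin by (intro affine_superset_of_aff_dim) (simp_all add: affine_dependent_iff_aff_dim_le)
    moreover have "A' \<noteq> {}"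
      using dep by (auto simp: affine_dependent_def)
    ultimately show False
      using A A' unfolding affine_simplex_def by blast
  qed
  ultimately show "finite A \<and> affine_dependent A \<and> (\<forall>A'. A' \<subset> A \<longrightarrow> \<not> affine_dependent A')"
    using S(1) by blast
next
  assume A: "finite A \<and> affine_dependent A \<and> (\<forall>A'. A' \<subset> A \<longrightarrow> \<not> affine_dependent A')"
  obtain x where x: "x \<in> A" "x \<in> affine hull (A - {x})"
    using A unfolding affine_dependent_def by blast
  have "\<not> affine_dependent (A - {x})"
    using A x(1) by blast
  then have "aff_dim (A - {x}) = int (card (A - {x})) - 1"
    using aff_dim_affine_independent[of "A - {x}"] by simp
  then have "aff_dim (A - {x}) = int (card A) - 2"
    using A x(1) card_Suc_Diff1[of A x] by linarith
  moreover have "affine hull A = affine hull (A - {x})"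
    using x by (metis hull_redundant insert_Diff)
  ultimately have "aff_dim (affine hull A) = int (card A) - 2"
    by (metis aff_dim_affine_hull)
  then have "\<exists>S. affine S \<and> aff_dim S = int (card A) - 2 \<and> A \<subseteq> S"
    by (intro exI[of _ "affine hull A"]) (simp add: hull_subset)
  moreover have "card A \<ge> 3"
  proof (rule ccontr)
    assume "\<not> card A \<ge> 3"
    then have "card A = 0 \<or> card A = 1 \<or> card A = 2"
      by linarith
    then have "A = {} \<or> (\<exists>a. A = {a}) \<or> (\<exists>a b. A = {a, b})"
      using A by (meson card_0_eq card_1_singletonE card_2_iff)
    then have "\<not> affine_dependent A"
      using affine_independent_2 affine_independent_1 affine_independent_0 by metis
    then show False
      using A by blast
  qed
  moreover have "\<not> (\<exists>S. affine S \<and> aff_dim S = int (card A') - 2 \<and> A' \<subseteq> S)"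
    if "A' \<subset> A" for A'
  proof
    assume "\<exists>S. affine S \<and> aff_dim S = int (card A') - 2 \<and> A' \<subseteq> S"
    then have "aff_dim A' \<le> int (card A') - 2"
      by (metis aff_dim_subset)
    then have "affine_dependent A'"
      using that A finite_subset by (subst affine_dependent_iff_aff_dim_le) auto
    then show False
      using A that by blast
  qed
  ultimately show "affine_simplex A"
    using A unfolding affine_simplex_def by blast
qed

section \<open>Affine dependence in the configuration\<close>

definition parabola_point :: "real \<Rightarrow> real ^ 3" where
  "parabola_point t = vector [t, t\<^sup>2, 0]"

definition apex1 :: "real ^ 3" where "apex1 = vector [0, 0, 1]"

definition apex2 :: "real ^ 3" where "apex2 = vector [1, 0, 1]"

definition has_opposites :: "real set \<Rightarrow> bool" where
  "has_opposites X \<longleftrightarrow> (\<exists>s>0. s \<in> X \<and> - s \<in> X)"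

definition configuration :: "real set \<Rightarrow> (real ^ 3) set" where
  "configuration X = insert apex1 (insert apex2 (parabola_point ` X))"

lemma coordinates [simp]:
  "parabola_point t $ 1 = t" "parabola_point t $ 2 = t\<^sup>2" "parabola_point t $ 3 = 0"
  "apex1 $ 1 = 0" "apex1 $ 2 = 0" "apex1 $ 3 = 1"
  "apex2 $ 1 = 1" "apex2 $ 2 = 0" "apex2 $ 3 = 1"
  by (simp_all add: parabola_point_def apex1_def apex2_def vector_3)

lemma inj_parabola_point: "inj parabola_point"
  by (metis coordinates(1) injI)

lemma parabola_point_eq_iff [simp]: "parabola_point s = parabola_point t \<longleftrightarrow> s = t"
  using inj_parabola_point by (auto dest: injD)

lemma apexes_distinct [simp]:
  "apex1 \<noteq> apex2" "apex2 \<noteq> apex1"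
  "parabola_point t \<noteq> apex1" "parabola_point t \<noteq> apex2"
  "apex1 \<noteq> parabola_point t" "apex2 \<noteq> parabola_point t"
  by (simp_all add: vec_eq_iff forall_3)

lemma apexes_notin_parabola [simp]:
  "apex1 \<notin> parabola_point ` X" "apex2 \<notin> parabola_point ` X"
  by auto

text \<open>
  Every independence statement below reduces to exhibiting, for each point, a plane
  \<open>a * x + b * y + c * z = d\<close> through all the other points.
\<close>

lemma affine_independent_if_separated:
  fixes A :: "(real ^ 3) set"
  assumes "\<And>p. p \<in> A \<Longrightarrow> \<exists>a b c d. (\<forall>q\<in>A - {p}. a * q$1 + b * q$2 + c * q$3 = d) \<and>
                                    a * p$1 + b * p$2 + c * p$3 \<noteq> d"
  shows "\<not> affine_dependent A"
proof
  assume "affine_dependent A"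
  then obtain p where p: "p \<in> A" "p \<in> affine hull (A - {p})"
    unfolding affine_dependent_def by blast
  obtain a b c d where on: "\<forall>q\<in>A - {p}. a * q$1 + b * q$2 + c * q$3 = d"
    and off: "a * p$1 + b * p$2 + c * p$3 \<noteq> d"
    using assms[OF p(1)] by blast
  have inner: "(vector [a, b, c] :: real ^ 3) \<bullet> q = a * q$1 + b * q$2 + c * q$3" for q
    by (simp add: inner_vec_def sum_3 vector_3)
  have "affine hull (A - {p}) \<subseteq> {q. (vector [a, b, c] :: real ^ 3) \<bullet> q = d}"
    using on by (intro hull_minimal affine_hyperplane) (auto simp: inner)
  then show False
    using p(2) off by (auto simp: inner)
qed

text \<open>
  Padding a set of at most two parameters to a pair avoids separate interpolation polynomials for
  the smaller sets.
\<close>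

lemma subset_doubleton_avoiding:
  fixes X :: "real set"
  assumes "finite X" "card X \<le> 2" "t \<notin> X"
  obtains a b where "X \<subseteq> {a, b}" "a \<noteq> t" "b \<noteq> t"
proof -
  have "card X = 0 \<or> card X = 1 \<or> card X = 2"
    using assms(2) by linarith
  then show thesis
    using that[of "t + 1" "t + 1"] that[of x x for x] that assms(1,3)
    by (force simp: card_1_singleton_iff card_2_iff)
qed

text \<open>
  Restricted to the parabola, a function \<open>a * x + y - d\<close> is a monic quadratic polynomial in the
  parameter, so \<open>a\<close> and \<open>d\<close> can be chosen to give it any two roots.  The
  coefficient of \<open>z\<close> is invisible on the parabola and is left to adjust the value at one point above the plane.
\<close>

lemma independent_with_one_apex:
  assumes X: "finite X" "card X \<le> 3" and w: "w \<in> {apex1, apex2}"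
  shows "\<not> affine_dependent (insert w (parabola_point ` X))"
proof (rule affine_independent_if_separated)
  fix p assume "p \<in> insert w (parabola_point ` X)"
  then consider "p = w" | t where "t \<in> X" "p = parabola_point t"
    by blast
  then show "\<exists>a b c d. (\<forall>q\<in>insert w (parabola_point ` X) - {p}. a * q$1 + b * q$2 + c * q$3 = d) \<and>
                       a * p$1 + b * p$2 + c * p$3 \<noteq> d"
  proof cases
    case 1
    show ?thesis
      by (rule exI[of _ 0], rule exI[of _ 0], rule exI[of _ 1], rule exI[of _ 0])
        (use 1 w in auto)
  next
    case 2
    have "card (X - {t}) \<le> 2"
      using X 2(1) by simp
    then obtain r s where rs: "X - {t} \<subseteq> {r, s}" and ne: "r \<noteq> t" "s \<noteq> t"
      using subset_doubleton_avoiding[of "X - {t}" t] X(1) by auto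
    have eq: "x\<^sup>2 - (r + s) * x + r * s = (x - r) * (x - s)" for x
      by (simp add: algebra_simps power2_eq_square)
    show ?thesis
    proof (rule exI[of _ "- (r + s)"], rule exI[of _ 1],
           rule exI[of _ "- (r * s) + (r + s) * w$1 "], rule exI[of _ "- (r * s)"], intro conjI ballI)
      fix q assume q: "q \<in> insert w (parabola_point ` X) - {p}"
      show "- (r + s) * q$1 + 1 * q$2 + (- (r * s) + (r + s) * w$1) * q$3 = - (r * s)"
      proof (cases "q = w")
        case True
        then show ?thesis
          using w by auto
      next
        case False
        then obtain x where "x \<in> X - {t}" "q = parabola_point x"
          using q 2 by auto
        then show ?thesis
          using eq[of x] rs by (auto simp: algebra_simps)
      qed
    next
      show "- (r + s) * p$1 + 1 * p$2 + (- (r * s) + (r + s) * w$1) * p$3 \<noteq> - (r * s)"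
        using eq[of t] ne 2(2) no_zero_divisors[of "t - r" "t - s"] by (simp add: algebra_simps)
    qed
  qed
qed

text \<open>
  With both apexes present, the coefficient of \<open>z\<close> can adjust the value at only one of them.  To
  separate a point of the parabola from the rest, the function must take equal values at both
  apexes, so it cannot involve \<open>x\<close>; this leaves \<open>y\<close>, which distinguishes the two parameters
  exactly if they are not opposite.  To separate one apex from the other, the quadratic
  \<open>(t - r) * (t - s)\<close> serves, because its linear coefficient \<open>- (r + s)\<close> does not vanish.
\<close>

lemma independent_with_both_apexes:
  assumes X: "finite X" "card X \<le> 2" "\<not> has_opposites X"
  shows "\<not> affine_dependent (configuration X)"
  unfolding configuration_def
proof (rule affine_independent_if_separated)
  obtain r s where rs: "X \<subseteq> {r, s}" "r \<noteq> s" "r + s \<noteq> 0"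
  proof -
    have "card X = 0 \<or> card X = 1 \<or> card X = 2"
      using X(2) by linarith
    then consider "X = {}" | x where "X = {x}" | x y where "X = {x, y}" "x \<noteq> y"
      using X(1) by (auto simp: card_1_singleton_iff card_2_iff)
    then show thesis
    proof cases
      case 1
      then show ?thesis using that[of 1 2] by simp
    next
      case 2
      \<comment> \<open>any parameter of absolute value different from that of \<open>x\<close> would do\<close>
      then show ?thesis using that[of x "\<bar>x\<bar> + 1"] by auto
    next
      case 3
      have "x + y \<noteq> 0"
      proof
        assume "x + y = 0"
        then have "y = - x" by simp
        then show False
          using 3 X(3) unfolding has_opposites_def
          by (cases "x > 0") (auto dest: spec[of _ x] spec[of _ "-x"])
      qed
      then show ?thesis using 3 that[of x y] by simp
    qed
  qed
  have sq: "r\<^sup>2 \<noteq> s\<^sup>2"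
    using rs by (auto simp: power2_eq_iff)
  let ?A = "insert apex1 (insert apex2 (parabola_point ` X))"
  fix p assume "p \<in> ?A"
  then consider "p = apex1" | "p = apex2" | "p = parabola_point r" | "p = parabola_point s"
    using rs by auto
  then show "\<exists>a b c d. (\<forall>q\<in>?A - {p}. a * q$1 + b * q$2 + c * q$3 = d) \<and>
                       a * p$1 + b * p$2 + c * p$3 \<noteq> d"
  proof cases
    case 1
    show ?thesis
      by (rule exI[of _ "- (r + s)"], rule exI[of _ 1],
          rule exI[of _ "r + s - r * s"], rule exI[of _ "- (r * s)"])
        (use 1 rs in \<open>auto simp: algebra_simps power2_eq_square\<close>)
  next
    case 2
    show ?thesis
      by (rule exI[of _ "- (r + s)"], rule exI[of _ 1],
          rule exI[of _ "- (r * s)"], rule exI[of _ "- (r * s)"])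
        (use 2 rs in \<open>auto simp: algebra_simps power2_eq_square\<close>)
  next
    case 3
    show ?thesis
      by (rule exI[of _ 0], rule exI[of _ 1], rule exI[of _ "s\<^sup>2"], rule exI[of _ "s\<^sup>2"])
        (use 3 rs sq in auto)
  next
    case 4
    show ?thesis
      by (rule exI[of _ 0], rule exI[of _ 1], rule exI[of _ "r\<^sup>2"], rule exI[of _ "r\<^sup>2"])
        (use 4 rs sq in auto)
  qed
qed

text \<open>More than three points of the plane \<open>z = 0\<close> are dependent for reasons of dimension.\<close>

lemma affine_dependent_parabola:
  assumes "finite X" "card X \<ge> 4"
  shows "affine_dependent (parabola_point ` X)"
proof -
  have "parabola_point ` X \<subseteq> {q. axis 3 1 \<bullet> q = 0}"
    by (auto simp: inner_axis')
  then have "aff_dim (parabola_point ` X) \<le> aff_dim {q :: real ^ 3. axis 3 1 \<bullet> q = 0}"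
    by (rule aff_dim_subset)
  also have "\<dots> = 2"
    by (subst aff_dim_hyperplane) (auto simp: axis_eq_0_iff)
  finally show ?thesis
    using assms card_image[OF inj_on_subset[OF inj_parabola_point subset_UNIV], of X]
    by (subst affine_dependent_iff_aff_dim_le) auto
qed

text \<open>
  The points with parameters \<open>s\<close> and \<open>- s\<close> have the same height on the parabola, so they differ by
  \<open>2 * s\<close> times the difference of the two apexes.
\<close>

lemma affine_dependent_opposites:
  assumes "has_opposites X"
  shows "affine_dependent (configuration X)"
proof -
  obtain s where s: "s > 0" "s \<in> X" "- s \<in> X"
    using assms unfolding has_opposites_def by blast
  have "parabola_point s = 1 *\<^sub>R parabola_point (- s) + (2 * s) *\<^sub>R apex2 + (- 2 * s) *\<^sub>R apex1"
    by (simp add: vec_eq_iff forall_3)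
  then have "parabola_point s \<in> affine hull {parabola_point (- s), apex2, apex1}"
    unfolding affine_hull_3 by (intro CollectI exI[of _ 1] exI[of _ "2 * s"] exI[of _ "- 2 * s"]) simp
  moreover have "{parabola_point (- s), apex2, apex1} \<subseteq>
      configuration X - {parabola_point s}"
    using s by (auto simp: configuration_def)
  ultimately show ?thesis
    using s(2) hull_mono unfolding affine_dependent_def configuration_def by blast
qed

lemma affine_dependent_triple_apexes:
  assumes "finite X" "card X \<ge> 3"
  shows "affine_dependent (configuration X)"
  by (rule affine_dependent_biggerset)
    (use assms in \<open>auto simp: configuration_def card_insert_if card_image inj_on_def\<close>)


lemma affine_dependent_parabola_iff:
  assumes "finite X"
  shows "affine_dependent (parabola_point ` X) \<longleftrightarrow> card X \<ge> 4"
proof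
  assume "affine_dependent (parabola_point ` X)"
  then have "affine_dependent (insert apex1 (parabola_point ` X))"
    by (rule affine_dependent_subset) blast
  then show "card X \<ge> 4"
    using independent_with_one_apex[OF assms, of apex1] by force
qed (rule affine_dependent_parabola[OF assms])

lemma affine_dependent_one_apex_iff:
  assumes "finite X" "w \<in> {apex1, apex2}"
  shows "affine_dependent (insert w (parabola_point ` X)) \<longleftrightarrow> card X \<ge> 4"
proof
  assume "affine_dependent (insert w (parabola_point ` X))"
  then show "card X \<ge> 4"
    using independent_with_one_apex[OF assms(1) _ assms(2)] by force
next
  assume "card X \<ge> 4"
  then show "affine_dependent (insert w (parabola_point ` X))"
    using affine_dependent_parabola[OF assms(1)] by (meson affine_dependent_subset subset_insertI)
qed

lemma affine_dependent_configuration_iff: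
  assumes "finite X"
  shows "affine_dependent (configuration X) \<longleftrightarrow> card X \<ge> 3 \<or> has_opposites X"
  using independent_with_both_apexes[OF assms] affine_dependent_triple_apexes[OF assms]
    affine_dependent_opposites by force

text \<open>
  The three cases follow the number of apexes that the subset contains; the last one is again a
  configuration, over fewer parameters.
\<close>

lemma configuration_subset_cases:
  assumes "A \<subseteq> configuration T"
  obtains X where "X \<subseteq> T" "A = parabola_point ` X"
  | X w where "X \<subseteq> T" "w \<in> {apex1, apex2}" "A = insert w (parabola_point ` X)"
  | X where "X \<subseteq> T" "A = configuration X"
proof -
  define X where "X = {t \<in> T. parabola_point t \<in> A}"
  have "X \<subseteq> T"
    by (auto simp: X_def)
  moreover have "A = parabola_point ` X \<or> A = insert apex1 (parabola_point ` X) \<or>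
        A = insert apex2 (parabola_point ` X) \<or> A = configuration X"
    using assms unfolding configuration_def X_def
    by (cases "apex1 \<in> A"; cases "apex2 \<in> A") auto
  ultimately show thesis
    using that by blast
qed

lemma configuration_mono: "X \<subseteq> Y \<Longrightarrow> configuration X \<subseteq> configuration Y"
  unfolding configuration_def by blast

lemma configuration_eq_iff [simp]: "configuration X = configuration Y \<longleftrightarrow> X = Y"
proof
  assume "configuration X = configuration Y"
  then have "parabola_point t \<in> configuration X \<longleftrightarrow> parabola_point t \<in> configuration Y" for t
    by simp
  then show "X = Y"
    by (auto simp: configuration_def inj_image_mem_iff[OF inj_parabola_point])
qed simp

lemma has_opposites_card:
  assumes "has_opposites X" "finite X"
  shows "card X \<ge> 2"
proof -
  obtain s where "s > 0" "{s, - s} \<subseteq> X"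
    using assms(1) unfolding has_opposites_def by auto
  then show ?thesis
    using card_mono[OF assms(2), of "{s, - s}"] by simp
qed

lemma affine_simplex_parabola_iff:
  assumes X: "finite X"
  shows "affine_simplex (parabola_point ` X) \<longleftrightarrow> card X = 4"
proof
  assume "affine_simplex (parabola_point ` X)"
  then have dep: "affine_dependent (parabola_point ` X)"
    and min: "\<And>A. A \<subset> parabola_point ` X \<Longrightarrow> \<not> affine_dependent A"
    unfolding affine_simplex_iff_minimal_dependent by auto
  have "card X \<ge> 4"
    using dep X by (simp add: affine_dependent_parabola_iff)
  then obtain Y where Y: "Y \<subseteq> X" "card Y = 4" "finite Y"
    by (rule obtain_subset_with_card_n)
  have "affine_dependent (parabola_point ` Y)"
    using Y by (simp add: affine_dependent_parabola_iff)
  then have "\<not> parabola_point ` Y \<subset> parabola_point ` X"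
    using min by blast
  then have "Y = X"
    using image_mono[OF Y(1), of parabola_point]
    by (simp add: psubset_eq inj_image_eq_iff[OF inj_parabola_point])
  then show "card X = 4"
    using Y(2) by simp
next
  assume card: "card X = 4"
  have "\<not> affine_dependent A" if "A \<subset> parabola_point ` X" for A
  proof -
    obtain Y where Y: "Y \<subset> X" "A = parabola_point ` Y"
      using \<open>A \<subset> parabola_point ` X\<close> by (metis psubset_eq subset_imageE)
    then have "card Y < 4" "finite Y"
      using card psubset_card_mono[OF X Y(1)] finite_subset[OF _ X] by auto
    then show ?thesis
      using Y(2) by (simp add: affine_dependent_parabola_iff)
  qed
  then show "affine_simplex (parabola_point ` X)"
    unfolding affine_simplex_iff_minimal_dependent
    using X card by (simp add: affine_dependent_parabola_iff)
qed

text \<open>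
  Adding a single apex to points of the parabola does not affect dependence, so the apex can be
  dropped and the set is not minimal.
\<close>

lemma not_affine_simplex_one_apex:
  assumes "finite X" "w \<in> {apex1, apex2}"
  shows "\<not> affine_simplex (insert w (parabola_point ` X))"
proof
  assume "affine_simplex (insert w (parabola_point ` X))"
  moreover have "parabola_point ` X \<subset> insert w (parabola_point ` X)"
    using assms(2) apexes_notin_parabola by blast
  ultimately show False
    using affine_dependent_parabola_iff[OF assms(1)] affine_dependent_one_apex_iff[OF assms]
    unfolding affine_simplex_iff_minimal_dependent by blast
qed

text \<open>
  Minimality excludes four points on the parabola, and it excludes a third point beside an opposite
  pair because the pair and the apexes alone are dependent.
\<close>

lemma affine_simplex_configuration_iff:
  assumes X: "finite X"
  shows "affine_simplex (configuration X) \<longleftrightarrow>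
           card X = 2 \<and> has_opposites X \<or> card X = 3 \<and> \<not> has_opposites X"
proof
  assume "affine_simplex (configuration X)"
  then have dep: "affine_dependent (configuration X)"
    and min: "\<And>A. A \<subset> configuration X \<Longrightarrow> \<not> affine_dependent A"
    unfolding affine_simplex_iff_minimal_dependent by auto
  have "parabola_point ` X \<subset> configuration X"
    unfolding configuration_def using apexes_notin_parabola(1) by blast
  then have card: "card X \<le> 3"
    using min[of "parabola_point ` X"] X by (simp add: affine_dependent_parabola_iff)
  show "card X = 2 \<and> has_opposites X \<or> card X = 3 \<and> \<not> has_opposites X"
  proof (cases "has_opposites X")
    case True
    then obtain s where s: "s > 0" "{s, - s} \<subseteq> X"
      unfolding has_opposites_def by auto
    have "affine_dependent (configuration {s, - s})"
      using s(1) by (intro affine_dependent_opposites) (auto simp: has_opposites_def)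
    then have "\<not> configuration {s, - s} \<subset> configuration X"
      using min by blast
    then have "X = {s, - s}"
      using configuration_mono[OF s(2)] by auto
    then have "card X = 2"
      using s(1) by simp
    then show ?thesis
      using True by simp
  next
    case False
    then show ?thesis
      using dep card X by (simp add: affine_dependent_configuration_iff)
  qed
next
  assume card: "card X = 2 \<and> has_opposites X \<or> card X = 3 \<and> \<not> has_opposites X"
  have "\<not> affine_dependent A" if A: "A \<subset> configuration X" for A
  proof -
    have "A \<subseteq> configuration X"
      using A by blast
    then show ?thesis
    proof (cases rule: configuration_subset_cases)
      case (1 Y)
      then have "card Y \<le> 3" "finite Y"
        using card card_mono[OF X, of Y] finite_subset[OF _ X, of Y] by (linarith, blast)
      then show ?thesis
        using 1 by (simp add: affine_dependent_parabola_iff)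
    next
      case (2 Y w)
      then have "card Y \<le> 3" "finite Y"
        using card card_mono[OF X, of Y] finite_subset[OF _ X, of Y] by (linarith, blast)
      then show ?thesis
        using 2 by (simp add: affine_dependent_one_apex_iff)
    next
      case (3 Y)
      then have "Y \<subset> X"
        using A by auto
      then have Y: "card Y < card X" "finite Y"
        using psubset_card_mono[OF X] finite_subset[OF _ X] by auto
      have "\<not> has_opposites Y"
      proof
        assume opp: "has_opposites Y"
        then have "has_opposites X"
          using 3(1) unfolding has_opposites_def by blast
        then show False
          using card Y has_opposites_card[OF opp Y(2)] by linarith
      qed
      then show ?thesis
        using 3 Y card by (auto simp: affine_dependent_configuration_iff)
    qed
  qed
  moreover have "finite (configuration X)"
    using X by (simp add: configuration_def)
  ultimately show "affine_simplex (configuration X)"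
    unfolding affine_simplex_iff_minimal_dependent
    using X card by (auto simp: affine_dependent_configuration_iff)
qed

section \<open>Counting the affine simplexes\<close>

text \<open>Each pair \<open>{s, - s}\<close> is represented by its positive element, so \<open>0\<close> is in no pair.\<close>

definition opposite_pairs :: "real set \<Rightarrow> real set" where
  "opposite_pairs T = {s \<in> T. s > 0 \<and> - s \<in> T}"

lemma card_pairs_with_opposites:
  "card {X. X \<subseteq> T \<and> card X = 2 \<and> has_opposites X} = card (opposite_pairs T)"
proof -
  have "{X. X \<subseteq> T \<and> card X = 2 \<and> has_opposites X} = (\<lambda>s. {s, - s}) ` opposite_pairs T"
    (is "?L = ?R")
  proof
    show "?R \<subseteq> ?L"
      by (auto simp: opposite_pairs_def has_opposites_def)
    show "?L \<subseteq> ?R"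
    proof
      fix X assume "X \<in> ?L"
      then obtain s where X: "X \<subseteq> T" "card X = 2" and s: "s > 0" "{s, - s} \<subseteq> X"
        unfolding has_opposites_def by auto
      have "{s, - s} = X"
        using X(2) s card_ge_0_finite[of X] by (intro card_subset_eq) auto
      then show "X \<in> ?R"
        using X(1) s unfolding opposite_pairs_def by blast
    qed
  qed
  moreover have "inj_on (\<lambda>s. {s, - s}) (opposite_pairs T)"
    by (auto simp: inj_on_def opposite_pairs_def doubleton_eq_iff)
  ultimately show ?thesis
    by (simp add: card_image)
qed

text \<open>
  A triple contains at most one opposite pair, so it is determined by the positive element of the
  pair together with an arbitrary third parameter.
\<close>

lemma card_triples_with_opposites:
  assumes T: "finite T"
  shows "card {X. X \<subseteq> T \<and> card X = 3 \<and> has_opposites X} = card (opposite_pairs T) * (card T - 2)"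
proof -
  let ?S = "SIGMA s:opposite_pairs T. T - {s, - s}"
  have "{X. X \<subseteq> T \<and> card X = 3 \<and> has_opposites X} = (\<lambda>(s, r). {s, - s, r}) ` ?S"
    (is "?L = ?R")
  proof
    show "?R \<subseteq> ?L"
      by (auto simp: opposite_pairs_def has_opposites_def)
    show "?L \<subseteq> ?R"
    proof
      fix X assume "X \<in> ?L"
      then obtain s where X: "X \<subseteq> T" "card X = 3" and s: "s > 0" "{s, - s} \<subseteq> X"
        unfolding has_opposites_def by auto
      have "card (X - {s, - s}) = 1"
        using X(2) s by (subst card_Diff_subset) auto
      then obtain r where "X - {s, - s} = {r}"
        by (auto simp: card_1_singleton_iff)
      then have "X = {s, - s, r}" "r \<notin> {s, - s}"
        using s(2) by auto
      then show "X \<in> ?R"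
        using X(1) s unfolding opposite_pairs_def by force
    qed
  qed
  moreover have "inj_on (\<lambda>(s, r). {s, - s, r}) ?S"
  proof (rule inj_onI)
    fix x y assume x: "x \<in> ?S" and y: "y \<in> ?S"
      and xy: "(\<lambda>(s, r). {s, - s, r}) x = (\<lambda>(s, r). {s, - s, r}) y"
    obtain s r s' r' where xy_def: "x = (s, r)" "y = (s', r')"
      by (cases x; cases y)
    have s: "s \<in> opposite_pairs T" "s' \<in> opposite_pairs T"
      and r: "r \<notin> {s, - s}" "r' \<notin> {s', - s'}"
      and eq: "{s, - s, r} = {s', - s', r'}"
      using x y xy by (simp_all add: xy_def)
    have pos: "s > 0" "s' > 0"
      using s by (simp_all add: opposite_pairs_def)
    have "s' \<in> {s, - s, r}" "- s' \<in> {s, - s, r}"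
      using eq by auto
    then have "s' = s"
      using pos by auto
    then show "x = y"
      using eq r by (auto simp: xy_def)
  qed
  moreover have "card ?S = card (opposite_pairs T) * (card T - 2)"
  proof -
    have "card (T - {s, - s}) = card T - 2" if "s \<in> opposite_pairs T" for s
      using that by (subst card_Diff_subset) (auto simp: opposite_pairs_def)
    then show ?thesis
      using T by (simp add: card_SigmaI opposite_pairs_def)
  qed
  ultimately show ?thesis
    by (simp add: card_image)
qed

text \<open>
  The term counting triples with an opposite pair stands on the left because the subtraction of
  natural numbers truncates.
\<close>

lemma num_affine_simplexes_configuration:
  assumes T: "finite T"
  shows "num_affine_simplexes (configuration T) + card (opposite_pairs T) * (card T - 2) =
           (card T choose 4) + (card T choose 3) + card (opposite_pairs T)"
proof -
  let ?A = "{X. X \<subseteq> T \<and> card X = 4}"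
  let ?B = "{X. X \<subseteq> T \<and> card X = 2 \<and> has_opposites X}"
  let ?C = "{X. X \<subseteq> T \<and> card X = 3 \<and> \<not> has_opposites X}"
  let ?D = "{X. X \<subseteq> T \<and> card X = 3 \<and> has_opposites X}"
  have fin: "finite {X. X \<subseteq> T \<and> Q X}" for Q
    using T by simp
  have sub: "finite X" if "X \<subseteq> T" for X
    using that T finite_subset by blast
  have "{A. A \<subseteq> configuration T \<and> affine_simplex A} =
          (`) parabola_point ` ?A \<union> configuration ` (?B \<union> ?C)" (is "?L = ?R")
  proof
    show "?L \<subseteq> ?R"
    proof
      fix A assume "A \<in> ?L"
      then have A: "A \<subseteq> configuration T" "affine_simplex A"
        by auto
      from A(1) show "A \<in> ?R"
      proof (cases rule: configuration_subset_cases)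
        case (1 X)
        then show ?thesis
          using A(2) by (simp add: affine_simplex_parabola_iff sub)
      next
        case (2 X w)
        then show ?thesis
          using A(2) not_affine_simplex_one_apex[OF sub[OF 2(1)] 2(2)] by simp
      next
        case (3 X)
        then show ?thesis
          using A(2) by (auto simp: affine_simplex_configuration_iff sub)
      qed
    qed
    have "parabola_point ` X \<subseteq> configuration T" if "X \<subseteq> T" for X
      using that by (auto simp: configuration_def)
    then show "?R \<subseteq> ?L"
      by (auto simp: affine_simplex_parabola_iff affine_simplex_configuration_iff sub
          dest: configuration_mono[THEN subsetD])
  qed
  moreover have "card ((`) parabola_point ` ?A \<union> configuration ` (?B \<union> ?C)) =
                   card ?A + (card ?B + card ?C)"
  proof -
    have "parabola_point ` X \<noteq> configuration Y" for X Y
      using apexes_notin_parabola(1)[of X] by (auto simp: configuration_def simp del: apexes_notin_parabola)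
    then have "card ((`) parabola_point ` ?A \<union> configuration ` (?B \<union> ?C)) =
        card ((`) parabola_point ` ?A) + card (configuration ` (?B \<union> ?C))"
      using fin by (intro card_Un_disjoint) auto
    also have "card ((`) parabola_point ` ?A) = card ?A"
      by (intro card_image inj_onI) (simp add: inj_image_eq_iff inj_parabola_point)
    also have "card (configuration ` (?B \<union> ?C)) = card (?B \<union> ?C)"
      by (intro card_image inj_onI) simp
    also have "card (?B \<union> ?C) = card ?B + card ?C"
      using fin by (intro card_Un_disjoint) auto
    finally show ?thesis .
  qed
  moreover have "card ?C + card ?D = card T choose 3"
  proof -
    have "card ?C + card ?D = card (?C \<union> ?D)"
      using fin by (intro card_Un_disjoint[symmetric]) auto
    also have "?C \<union> ?D = {X. X \<subseteq> T \<and> card X = 3}"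
      by blast
    finally show ?thesis
      using T by (simp add: n_subsets)
  qed
  ultimately show ?thesis
    unfolding num_affine_simplexes_def
    using T by (simp add: n_subsets card_pairs_with_opposites card_triples_with_opposites)
qed

lemma card_configuration:
  assumes "finite T"
  shows "card (configuration T) = card T + 2"
  using assms by (simp add: configuration_def card_image inj_on_def)

lemma ex_balanced_set:
  "\<exists>T :: real set. finite T \<and> card T = N \<and> card (opposite_pairs T) = N div 2"
proof -
  define S where "S = real ` {1..N div 2}"
  define Z where "Z = (if even N then {} else {0 :: real})"
  define T where "T = S \<union> uminus ` S \<union> Z"
  have S: "finite S" "card S = N div 2" and pos: "\<And>s. s \<in> S \<Longrightarrow> s > 0"
    by (auto simp: S_def card_image)
  have "card T = card S + card (uminus ` S) + card Z"
  proof -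
    have "card (S \<union> uminus ` S) = card S + card (uminus ` S)"
      using S(1) by (intro card_Un_disjoint) (force dest: pos)+
    moreover have "card (S \<union> uminus ` S \<union> Z) = card (S \<union> uminus ` S) + card Z"
      using S(1) by (intro card_Un_disjoint) (auto simp: Z_def dest: pos)
    ultimately show ?thesis
      by (simp add: T_def)
  qed
  also have "card (uminus ` S) = card S"
    by (simp add: card_image)
  also have "card S + card S + card Z = N"
    by (auto simp: S(2) Z_def elim!: evenE oddE)
  finally have "card T = N" .
  moreover have "opposite_pairs T = S"
    by (auto simp: opposite_pairs_def T_def Z_def dest: pos split: if_splits)
  moreover have "finite T"
    using S(1) by (simp add: T_def Z_def)
  ultimately show ?thesis
    using S(2) by metis
qed

lemma ex_simplex_value:
  assumes "n \<ge> 2"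
  shows "\<exists>P :: (real ^ 3) set. finite P \<and> card P = n \<and> real (num_affine_simplexes P) = simplex_value n"
proof -
  define N where "N = n - 2"
  have n: "n = N + 2"
    using assms by (simp add: N_def)
  obtain T :: "real set" where T: "finite T" "card T = N" "card (opposite_pairs T) = N div 2"
    using ex_balanced_set by blast
  have "num_affine_simplexes (configuration T) + (N div 2) * (N - 2) =
          (Suc N choose 4) + N div 2"
    using num_affine_simplexes_configuration[OF T(1)] T(2,3)
    by (simp add: numeral_eq_Suc)
  then have "real (num_affine_simplexes (configuration T)) + real (N div 2) * real (N - 2) =
          real (Suc N choose 4) + real (N div 2)"
    by (metis of_nat_add of_nat_mult)
  \<comment> \<open>for \<open>N < 2\<close> the difference \<open>N - 2\<close> is truncated, but then \<open>N div 2 = 0\<close>\<close>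
  moreover have "real (N div 2) * real (N - 2) = real (N div 2) * (real N - 2)"
    by (cases "N \<ge> 2") (auto simp: of_nat_diff)
  ultimately have "real (num_affine_simplexes (configuration T)) =
      real (Suc N choose 4) - real (N div 2) * (real N - 3)"
    by (simp add: algebra_simps)
  also have "\<dots> = simplex_value n"
    by (cases "even N") (auto elim!: evenE oddE simp: simplex_value_def n field_simps)
  finally show ?thesis
    using T card_configuration[OF T(1)] n
    by (intro exI[of _ "configuration T"]) (auto simp: configuration_def)
qed

lemma choose_4_polynomial:
  "real (m choose 4) = real m * (real m - 1) * (real m - 2) * (real m - 3) / 24"
  using binomial_gbinomial[of m 4, where ?'a = real]
  by (simp add: gbinomial_prod_rev numeral_eq_Suc fact_numeral)

text \<open>
  The quartic and cubic terms come from the binomial coefficient alone and cancel, which leaves a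
  quadratic polynomial with leading coefficient \<open>23/24\<close> for either parity.
\<close>

lemma simplex_value_asymptotics:
  "(\<lambda>n. simplex_value n - (1 / 24 * real n ^ 4 - 5 / 12 * real n ^ 3)) \<in> O(\<lambda>n. real n ^ 2)"
proof (rule bigoI[of _ 20])
  show "\<forall>\<^sub>F n in sequentially.
    norm (simplex_value n - (1 / 24 * real n ^ 4 - 5 / 12 * real n ^ 3)) \<le> 20 * norm (real n ^ 2)"
    using eventually_ge_at_top[of 1]
  proof eventually_elim
    case (elim n)
    define x where "x = real n"
    have x: "1 \<le> x" "x \<le> x\<^sup>2"
      using elim by (auto simp: x_def power2_eq_square)
    have choose: "real ((n - 1) choose 4) = (x - 1) * (x - 2) * (x - 3) * (x - 4) / 24"
      using elim by (simp add: choose_4_polynomial of_nat_diff x_def)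
    have "simplex_value n - (1 / 24 * x ^ 4 - 5 / 12 * x ^ 3) =
        (if even n then (23 * x\<^sup>2 + 34 * x - 96) / 24 else (23 * x\<^sup>2 + 46 * x - 156) / 24)"
      unfolding simplex_value_def choose x_def[symmetric]
      by (simp add: field_simps power2_eq_square power3_eq_cube power4_eq_xxxx)
    moreover have "\<bar>(23 * x\<^sup>2 + 34 * x - 96) / 24\<bar> \<le> 20 * x\<^sup>2"
      and "\<bar>(23 * x\<^sup>2 + 46 * x - 156) / 24\<bar> \<le> 20 * x\<^sup>2"
      unfolding abs_le_iff using x by (simp_all add: field_simps)
    ultimately show ?case
      unfolding x_def[symmetric] real_norm_def by simp
  qed
qed

theorem proposition7:
  "(\<forall>n::nat. n \<ge> 2 \<longrightarrow>
      (\<exists>P :: (real ^ 3) set. finite P \<and> card P = n \<and>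
         real (num_affine_simplexes P) = simplex_value n)) \<and>
   (\<lambda>n::nat. simplex_value n - (1 / 24 * real n ^ 4 - 5 / 12 * real n ^ 3))
      \<in> O(\<lambda>n. real n ^ 2)"
  using ex_simplex_value simplex_value_asymptotics by blast

end
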